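(* For $11\leq n\leq 12$, $$\gamma^{LD}(\mathbb{F}^n)\geq \frac{2^{n+1}}{n+1+2(n-1)/(3(n-4))},$$ and for $n\geq 13$, $$\gamma^{LD}(\mathbb{F}^n)\geq \frac{2^{n+1}}{n+2+2/(n^2-5n)-4/(3n)}.$$
   Context: $\mathbb{F}^n$ is the binary Hamming space (binary words of length $n$, adjacent when they differ in exactly one coordinate). For a code $C\subseteq\mathbb{F}^n$ (nonempty set) and a word $\mathbf{u}$, $I(\mathbf{u})=C\cap N[\mathbf{u}]$, where $N[\mathbf{u}]$ is $\mathbf{u}$ together with all words at Hamming distance $1$ from $\mathbf{u}$. $C$ is locating-dominating if $I(\mathbf{u})\neq\emptyset$ for all words $\mathbf{u}$ and $I(\mathbf{u})\neq I(\mathbf{v})$ for all distinct words $\mathbf{u},\mathbf{v}\notin C$. $\gamma^{LD}(\mathbb{F}^n)$ denotes the minimum cardinality of a locating-dominating code in $\mathbb{F}^n$. *)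

theory Defs
  imports Complex_Main
begin

definition hamming_space :: "nat \<Rightarrow> bool list set" where
  "hamming_space n = {w. length w = n}"

text \<open>Only meaningful for words of equal length.\<close>

definition hamming_dist :: "bool list \<Rightarrow> bool list \<Rightarrow> nat" where
  "hamming_dist u v = card {i. i < length u \<and> u ! i \<noteq> v ! i}"

definition closed_nbhd :: "nat \<Rightarrow> bool list \<Rightarrow> bool list set" where
  "closed_nbhd n u = insert u {v \<in> hamming_space n. hamming_dist u v = 1}"

definition is_code :: "nat \<Rightarrow> bool list set \<Rightarrow> bool" where
  "is_code n C \<longleftrightarrow> C \<subseteq> hamming_space n \<and> C \<noteq> {}"

definition I_set :: "nat \<Rightarrow> bool list set \<Rightarrow> bool list \<Rightarrow> bool list set" where
  "I_set n C u = C \<inter> closed_nbhd n u"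

definition locating_dominating :: "nat \<Rightarrow> bool list set \<Rightarrow> bool" where
  "locating_dominating n C \<longleftrightarrow>
     is_code n C \<and>
     (\<forall>u \<in> hamming_space n. I_set n C u \<noteq> {}) \<and>
     (\<forall>u \<in> hamming_space n - C. \<forall>v \<in> hamming_space n - C.
        u \<noteq> v \<longrightarrow> I_set n C u \<noteq> I_set n C v)"

definition gamma_LD :: "nat \<Rightarrow> nat" where
  "gamma_LD n = (LEAST k. \<exists>C. locating_dominating n C \<and> card C = k)"

lemma locating_dominating_hamming_space:
  "locating_dominating n (hamming_space n)"
proof -
  have "replicate n False \<in> hamming_space n"
    by (simp add: hamming_space_def)
  then show ?thesis
    by (auto simp: locating_dominating_def is_code_def I_set_def closed_nbhd_def)
qed

lemma gamma_LD_attained: "\<exists>C. locating_dominating n C \<and> card C = gamma_LD n"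
  unfolding gamma_LD_def
  by (rule LeastI_ex) (use locating_dominating_hamming_space in blast)

lemma gamma_LD_le: "locating_dominating n C \<Longrightarrow> gamma_LD n \<le> card C"
  unfolding gamma_LD_def by (rule Least_le) blast

end

theory Submission
  imports Defs
begin

text \<open>
  The share of a codeword \<open>c\<close> is the sum of \<open>1 / |I(v)|\<close> over the closed neighbourhood of \<open>c\<close>.
  The shares add up to \<open>2\<^sup>n\<close>, so a lower bound for the average \<open>loss\<close>, that is
  \<open>(n + 3) / 2 - share\<close>, is a lower bound for \<open>|C|\<close>.  At most one noncodeword is covered by \<open>c\<close>
  alone, and two noncodewords next to \<open>c\<close> cannot both be covered by exactly \<open>c\<close> and \<open>c'\<close>.  Hence
  the loss of \<open>c\<close> is at least the required average \<open>\<theta>\<close> unless \<open>c\<close> is \<open>deficient\<close>, and then \<open>c\<close>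
  belongs to a \<open>star\<close>: a noncodeword \<open>u\<close> all of whose neighbours but \<open>u + e\<^sub>a\<close> are codewords.

  As \<open>u + e\<^sub>a\<close> must be covered, some \<open>u + e\<^sub>a + e\<^sub>b\<close> is a codeword, and then the other members of
  the star compensate for the deficient ones, unless all members but \<open>u + e\<^sub>b\<close> are deficient.  In
  this \<open>tight\<close> case the missing amount is taken from the codeword \<open>u + e\<^sub>a + e\<^sub>b\<close>, the \<open>apex\<close>, and,
  if a neighbour of the apex is the centre of a second star (with \<open>n - 2\<close> codewords), from the
  members of that star.
\<close>

section \<open>Sums of reciprocals\<close>

lemma inverse_add_inverse_le:
  fixes a b m :: real
  assumes "0 < m" "m \<le> a" "m \<le> b"
  shows "1 / a + 1 / b \<le> 1 / m + 1 / (a + b - m)"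
proof -
  have "0 \<le> (a - m) * (b - m)" using assms by simp
  then have "m * (a + b - m) \<le> a * b" by (simp add: algebra_simps)
  then have "(a + b) / (a * b) \<le> (a + b) / (m * (a + b - m))"
    using assms by (intro divide_left_mono) auto
  moreover have "(a + b) / (a * b) = 1 / a + 1 / b"
    using assms by (simp add: field_simps)
  moreover have "(a + b) / (m * (a + b - m)) = 1 / m + 1 / (a + b - m)"
    using assms by (simp add: field_simps)
  ultimately show ?thesis by linarith
qed

lemma half_minus_inverse_add_le:
  fixes a b :: real
  assumes "3 \<le> a" "3 \<le> b"
  shows "1 / 2 - 1 / (a + b) \<le> (1 / 2 - 1 / a) + (1 / 2 - 1 / b)"
proof -
  have "18 \<le> (a + b) * (a + b - 3)"
    using mult_mono[of 6 "a + b" 3 "a + b - 3"] assms by simp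
  then have "3 / ((a + b) * (a + b - 3)) \<le> 3 / 18"
    using assms by (intro divide_left_mono) auto
  moreover have "1 / (a + b - 3) - 1 / (a + b) = 3 / ((a + b) * (a + b - 3))"
    using assms by (simp add: field_simps)
  ultimately show ?thesis
    using inverse_add_inverse_le[of 3 a b] assms by linarith
qed

lemma half_minus_inverse_sum_le:
  fixes m :: "'a \<Rightarrow> real"
  assumes "finite Q" "Q \<noteq> {}" "\<forall>j\<in>Q. 3 \<le> m j"
  shows "1 / 2 - 1 / (\<Sum>j\<in>Q. m j) \<le> (\<Sum>j\<in>Q. 1 / 2 - 1 / m j)"
  using assms
proof (induction Q rule: finite_ne_induct)
  case (insert x F)
  have "3 \<le> m y" "m y \<le> sum m F" if "y \<in> F" for y
    using that insert.prems insert.hyps(1) by (auto intro!: member_le_sum intro: order_trans)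
  then have "3 \<le> sum m F" using insert.hyps(2) by fastforce
  then have "1 / 2 - 1 / (m x + sum m F) \<le> (1 / 2 - 1 / m x) + (1 / 2 - 1 / sum m F)"
    using insert.prems by (intro half_minus_inverse_add_le) auto
  then show ?case using insert by simp
qed simp

lemma sum_half_minus_inverse_ge:
  fixes m :: "'a \<Rightarrow> real"
  assumes ge_3: "2 \<le> card Q" "\<forall>j\<in>Q. 3 \<le> m j" and total: "3 < N" "N \<le> (\<Sum>j\<in>Q. m j)"
  shows "2 / 3 - 1 / (N - 3) \<le> (\<Sum>j\<in>Q. 1 / 2 - 1 / m j)"
proof -
  have finite_Q: "finite Q" using ge_3(1) card.infinite by fastforce
  obtain i where member: "i \<in> Q" using ge_3(1) by fastforce
  let ?R = "Q - {i}"
  have "card ?R \<noteq> 0" using ge_3(1) finite_Q member by simp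
  then have rest: "finite ?R" "?R \<noteq> {}" using finite_Q by (simp, metis card.empty)
  have split: "sum f Q = f i + sum f ?R" for f :: "'a \<Rightarrow> real"
    using finite_Q member by (rule sum.remove)
  have "3 \<le> sum m ?R"
  proof -
    obtain j where "j \<in> ?R" using rest(2) by blast
    then have "3 \<le> m j" "m j \<le> sum m ?R"
      using ge_3(2) rest(1) by (auto intro!: member_le_sum intro: order_trans[of 0 3])
    then show ?thesis by simp
  qed
  then have "1 / m i + 1 / sum m ?R \<le> 1 / 3 + 1 / (sum m Q - 3)"
    using inverse_add_inverse_le[of 3 "m i" "sum m ?R"] ge_3(2) member split[of m] by simp
  moreover have "1 / 2 - 1 / sum m ?R \<le> (\<Sum>j\<in>?R. 1 / 2 - 1 / m j)"
    using half_minus_inverse_sum_le rest ge_3(2) by blast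
  moreover have "1 / (sum m Q - 3) \<le> 1 / (N - 3)"
    using total by (intro divide_left_mono) auto
  ultimately show ?thesis using split[of "\<lambda>j. 1 / 2 - 1 / m j"] by linarith
qed

section \<open>Binary words\<close>

definition flip :: "nat \<Rightarrow> bool list \<Rightarrow> bool list" where
  "flip i w = w[i := \<not> w ! i]"

lemma length_flip [simp]: "length (flip i w) = length w"
  by (simp add: flip_def)

lemma nth_flip: "k < length w \<Longrightarrow> flip i w ! k = (if k = i then \<not> w ! k else w ! k)"
  by (simp add: flip_def nth_list_update)

lemma flip_flip [simp]: "flip i (flip i w) = w"
  by (rule nth_equalityI) (auto simp: nth_flip)

lemma flip_commute: "flip i (flip j w) = flip j (flip i w)"
  by (rule nth_equalityI) (auto simp: nth_flip)

lemma flip_in_hamming_space_iff [simp]: "flip i w \<in> hamming_space n \<longleftrightarrow> w \<in> hamming_space n"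
  by (simp add: hamming_space_def)

lemma flip_neq: "i < length w \<Longrightarrow> flip i w \<noteq> w"
  by (metis nth_flip)

lemma inj_on_flip: "inj_on (\<lambda>i. flip i w) {..<length w}"
  by (rule inj_onI) (metis lessThan_iff nth_flip)

lemma hamming_dist_eq_1_iff:
  assumes "length v = length u"
  shows "hamming_dist u v = 1 \<longleftrightarrow> (\<exists>i<length u. v = flip i u)"
proof
  assume "hamming_dist u v = 1"
  then obtain i where differ: "{k. k < length u \<and> u ! k \<noteq> v ! k} = {i}"
    by (auto simp: hamming_dist_def card_1_singleton_iff)
  then have "v ! k = flip i u ! k" if "k < length u" for k
    using that by (auto simp: nth_flip)
  then have "v = flip i u" using assms by (simp add: nth_equalityI)
  then show "\<exists>i<length u. v = flip i u" using differ by blast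
next
  assume "\<exists>i<length u. v = flip i u"
  then obtain i where "i < length u" "v = flip i u" by blast
  then have "{k. k < length u \<and> u ! k \<noteq> v ! k} = {i}"
    by (auto simp: nth_flip split: if_splits)
  then show "hamming_dist u v = 1" by (simp add: hamming_dist_def)
qed

lemma closed_nbhd_eq_flips:
  assumes "u \<in> hamming_space n"
  shows "closed_nbhd n u = insert u ((\<lambda>i. flip i u) ` {..<n})"
  using assms
  by (auto simp: closed_nbhd_def hamming_space_def hamming_dist_eq_1_iff simp del: One_nat_def)

lemma finite_hamming_space: "finite (hamming_space n)"
  using finite_lists_length_eq[of "UNIV :: bool set" n] by (simp add: hamming_space_def)

lemma card_hamming_space: "card (hamming_space n) = 2 ^ n"
  using card_lists_length_eq[of "UNIV :: bool set" n] by (simp add: hamming_space_def)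

lemma sum_flip_swap:
  assumes "finite A" "finite B"
  shows "(\<Sum>v\<in>A. \<Sum>i | i < n \<and> flip i v \<in> B. g v i)
    = (\<Sum>w\<in>B. \<Sum>i | i < n \<and> flip i w \<in> A. g (flip i w) i)"
proof -
  have "(\<Sum>v\<in>A. \<Sum>i | i < n \<and> flip i v \<in> B. g v i)
      = (\<Sum>(v, i)\<in>(SIGMA v:A. {i. i < n \<and> flip i v \<in> B}). g v i)"
    using assms by (intro sum.Sigma) auto
  also have "\<dots> = (\<Sum>(w, i)\<in>(SIGMA w:B. {i. i < n \<and> flip i w \<in> A}). g (flip i w) i)"
    by (rule sum.reindex_bij_witness[of _ "\<lambda>(w, i). (flip i w, i)" "\<lambda>(v, i). (flip i v, i)"]) auto
  also have "\<dots> = (\<Sum>w\<in>B. \<Sum>i | i < n \<and> flip i w \<in> A. g (flip i w) i)"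
    using assms by (intro sum.Sigma[symmetric]) auto
  finally show ?thesis .
qed

section \<open>Shares of codewords\<close>

locale ld_code =
  fixes n :: nat and C :: "bool list set"
  assumes locating_dominating: "locating_dominating n C"
begin

definition dirs :: "bool list \<Rightarrow> nat set" where
  "dirs v = {i. i < n \<and> flip i v \<in> C}"

definition cov :: "bool list \<Rightarrow> nat" where
  "cov v = card (dirs v) + of_bool (v \<in> C)"

definition private_dirs :: "bool list \<Rightarrow> nat set" where
  "private_dirs c = {i. i < n \<and> cov (flip i c) = 1}"

definition heavy_dirs :: "bool list \<Rightarrow> nat set" where
  "heavy_dirs c = {i. i < n \<and> 3 \<le> cov (flip i c)}"

definition share :: "bool list \<Rightarrow> real" where
  "share c = 1 / cov c + (\<Sum>i<n. 1 / cov (flip i c))"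

definition loss :: "bool list \<Rightarrow> real" where
  "loss c = (real n + 3) / 2 - share c"

definition gain :: "bool list \<Rightarrow> nat \<Rightarrow> real" where
  "gain c i = 1 / 2 - 1 / cov (flip i c)"

lemma code_in_space: "c \<in> C \<Longrightarrow> c \<in> hamming_space n"
  using locating_dominating by (auto simp: locating_dominating_def is_code_def)

lemma finite_code: "finite C"
  using finite_subset[OF _ finite_hamming_space] code_in_space by blast

lemma dirs_iff: "i \<in> dirs v \<longleftrightarrow> i < n \<and> flip i v \<in> C"
  by (simp add: dirs_def)

lemma finite_dirs [simp]: "finite (dirs v)"
  by (simp add: dirs_def)

lemma finite_private_dirs [simp]: "finite (private_dirs c)"
  by (simp add: private_dirs_def)

lemma finite_heavy_dirs [simp]: "finite (heavy_dirs c)"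
  by (simp add: heavy_dirs_def)

lemma self_in_dirs_flip: "c \<in> C \<Longrightarrow> i < n \<Longrightarrow> i \<in> dirs (flip i c)"
  by (simp add: dirs_iff)

lemma in_dirs_flip_commute: "i < n \<Longrightarrow> j < n \<Longrightarrow> i \<in> dirs (flip j v) \<longleftrightarrow> j \<in> dirs (flip i v)"
  by (simp add: dirs_iff flip_commute)

lemma I_set_eq:
  assumes "v \<in> hamming_space n"
  shows "I_set n C v = (\<lambda>i. flip i v) ` dirs v \<union> (C \<inter> {v})"
  using assms by (auto simp: I_set_def closed_nbhd_eq_flips dirs_def)

lemma cov_eq_card_I_set:
  assumes word: "v \<in> hamming_space n"
  shows "cov v = card (I_set n C v)"
proof -
  have length_v: "length v = n" using word by (simp add: hamming_space_def)
  have dirs: "i < length v" if "i \<in> dirs v" for i using that by (simp add: dirs_iff length_v)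
  then have "inj_on (\<lambda>i. flip i v) (dirs v)" by (intro inj_on_subset[OF inj_on_flip]) auto
  moreover have "(\<lambda>i. flip i v) ` dirs v \<inter> (C \<inter> {v}) = {}"
    using flip_neq dirs by blast
  ultimately have "card (I_set n C v) = card (dirs v) + card (C \<inter> {v})"
    unfolding I_set_eq[OF word] by (simp add: card_Un_disjoint card_image)
  then show ?thesis by (simp add: cov_def)
qed

lemma cov_pos:
  assumes "v \<in> hamming_space n"
  shows "0 < cov v"
proof -
  have "I_set n C v \<noteq> {}"
    using locating_dominating assms by (simp add: locating_dominating_def)
  then show ?thesis
    using assms by (simp add: cov_eq_card_I_set card_gt_0_iff I_set_eq)
qed

lemma noncode_eqI:
  assumes "u \<in> hamming_space n - C" "v \<in> hamming_space n - C"
    and "(\<lambda>i. flip i u) ` dirs u = (\<lambda>i. flip i v) ` dirs v"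
  shows "u = v"
proof -
  have "I_set n C u = I_set n C v" using assms by (simp add: I_set_eq)
  then show ?thesis using locating_dominating assms(1,2) by (auto simp: locating_dominating_def)
qed

lemma inj_flip_code:
  assumes "c \<in> C" "i < n" "j < n" "flip i c = flip j c"
  shows "i = j"
  using inj_onD[OF inj_on_flip[of c]] assms code_in_space[of c] by (simp add: hamming_space_def)

lemma card_le_cov: "S \<subseteq> dirs v \<Longrightarrow> card S \<le> cov v"
  by (simp add: cov_def card_mono trans_le_add1)

lemma card_less_cov: "v \<in> C \<Longrightarrow> S \<subseteq> dirs v \<Longrightarrow> card S < cov v"
  by (simp add: cov_def card_mono less_Suc_eq_le)

lemma cov_noncode: "v \<notin> C \<Longrightarrow> cov v = card (dirs v)"
  by (simp add: cov_def)

lemma private_dirs_iff: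
  assumes "c \<in> C"
  shows "i \<in> private_dirs c \<longleftrightarrow> i < n \<and> flip i c \<notin> C \<and> dirs (flip i c) = {i}"
proof (cases "i < n")
  case True
  then have self: "i \<in> dirs (flip i c)" using assms by (rule self_in_dirs_flip[rotated])
  then have "cov (flip i c) = 1 \<longleftrightarrow> flip i c \<notin> C \<and> card (dirs (flip i c)) = 1"
    using card_less_cov[of "flip i c" "{i}"] by (auto simp: cov_def)
  then show ?thesis using True self by (auto simp: private_dirs_def card_1_singleton_iff)
qed (simp add: private_dirs_def)

lemma private_dirs_unique:
  assumes code: "c \<in> C" and "i \<in> private_dirs c" "j \<in> private_dirs c"
  shows "i = j"
proof -
  note single_nbr = assms(2,3)[unfolded private_dirs_iff[OF code]]
  have "flip i c = flip j c"
    using single_nbr code_in_space[OF code] by (intro noncode_eqI) auto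
  then show ?thesis using inj_flip_code[OF code] single_nbr by blast
qed

lemma card_private_dirs_le: "c \<in> C \<Longrightarrow> card (private_dirs c) \<le> 1"
  using private_dirs_unique by (simp add: card_le_Suc0_iff_eq)

lemma two_le_cov_flip:
  assumes "c \<in> C" "i < n" "i \<notin> private_dirs c"
  shows "2 \<le> cov (flip i c)"
  using cov_pos[of "flip i c"] code_in_space assms by (force simp: private_dirs_def)

lemma heavy_dirsI:
  assumes "i < n" "{j, k, l} \<subseteq> dirs (flip i c)" "j \<noteq> k" "j \<noteq> l" "k \<noteq> l"
  shows "i \<in> heavy_dirs c"
  using card_le_cov[OF assms(2)] assms by (simp add: heavy_dirs_def)

lemma heavy_dirs_codeI:
  assumes "i \<in> dirs c" "{j, k} \<subseteq> dirs (flip i c)" "j \<noteq> k"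
  shows "i \<in> heavy_dirs c"
  using card_less_cov[OF _ assms(2)] assms by (simp add: heavy_dirs_def dirs_iff)

text \<open>The two common neighbours of \<open>c\<close> and \<open>c + e\<^sub>i + e\<^sub>j\<close> cannot both have exactly these two
  words as their \<open>I\<close>-set.\<close>

lemma heavy_dirs_cover:
  assumes code: "c \<in> C" and noncode: "i < n" "i \<notin> dirs c" "i \<notin> private_dirs c"
  obtains j where "j \<in> heavy_dirs c" "i \<in> dirs (flip j c)"
proof (cases "i \<in> heavy_dirs c")
  case True
  then show ?thesis using that self_in_dirs_flip[OF code noncode(1)] by blast
next
  case False
  then have "cov (flip i c) = 2"
    using two_le_cov_flip[OF code noncode(1,3)] noncode(1) by (simp add: heavy_dirs_def)
  then have "card (dirs (flip i c)) = 2" using noncode by (simp add: cov_noncode dirs_iff)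
  moreover have "i \<in> dirs (flip i c)" using code noncode(1) by (rule self_in_dirs_flip)
  ultimately obtain j where two_nbrs: "dirs (flip i c) = {i, j}" "i \<noteq> j"
    unfolding card_2_iff by (metis empty_iff insert_commute insert_iff)
  then have less_j: "j < n" using dirs_iff by blast
  have both: "{i, j} \<subseteq> dirs (flip j c)"
    using two_nbrs in_dirs_flip_commute[OF noncode(1) less_j] self_in_dirs_flip[OF code less_j]
    by auto
  have "j \<in> heavy_dirs c"
  proof (rule ccontr)
    assume light: "j \<notin> heavy_dirs c"
    then have noncode_j: "flip j c \<notin> C"
      using heavy_dirs_codeI[of j c i j] both two_nbrs(2) less_j by (auto simp: dirs_iff)
    moreover have "card (dirs (flip j c)) \<le> 2"
      using light noncode_j less_j by (simp add: heavy_dirs_def cov_noncode)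
    then have "dirs (flip j c) = {i, j}"
      using card_seteq[OF finite_dirs both] two_nbrs(2) by simp
    ultimately have "flip i c = flip j c"
      using two_nbrs noncode code_in_space[OF code]
      by (intro noncode_eqI) (auto simp: dirs_iff flip_commute insert_commute)
    then show False using inj_flip_code[OF code noncode(1) less_j] two_nbrs(2) by blast
  qed
  then show ?thesis using that both by blast
qed

lemma sum_cov_heavy_dirs_ge:
  assumes code: "c \<in> C"
  shows "n \<le> card (dirs c) + card (private_dirs c) + (\<Sum>j\<in>heavy_dirs c. cov (flip j c))"
proof -
  let ?U = "\<Union>j\<in>heavy_dirs c. dirs (flip j c)"
  have "{..<n} \<subseteq> (dirs c \<union> private_dirs c) \<union> ?U"
    using heavy_dirs_cover[OF code] by blast
  then have "card {..<n} \<le> card ((dirs c \<union> private_dirs c) \<union> ?U)"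
    by (intro card_mono) auto
  also have "\<dots> \<le> card (dirs c) + card (private_dirs c) + card ?U"
    by (meson add_le_mono1 card_Un_le le_trans)
  also have "card ?U \<le> (\<Sum>j\<in>heavy_dirs c. card (dirs (flip j c)))"
    by (rule card_UN_le) simp
  also have "\<dots> \<le> (\<Sum>j\<in>heavy_dirs c. cov (flip j c))"
    by (intro sum_mono) (simp add: cov_def)
  finally show ?thesis by simp
qed

lemma sum_share: "(\<Sum>c\<in>C. share c) = 2 ^ n"
proof -
  let ?W = "hamming_space n" and ?f = "\<lambda>v. 1 / real (cov v)"
  have "(\<Sum>c\<in>C. \<Sum>i<n. ?f (flip i c)) = (\<Sum>c\<in>C. \<Sum>i | i < n \<and> flip i c \<in> ?W. ?f (flip i c))"
    using code_in_space by (intro sum.cong) auto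
  also have "\<dots> = (\<Sum>v\<in>?W. \<Sum>i\<in>dirs v. ?f v)"
    using sum_flip_swap[OF finite_code finite_hamming_space, of "\<lambda>c i. ?f (flip i c)"]
    by (simp add: dirs_def)
  finally have nbrs: "(\<Sum>c\<in>C. \<Sum>i<n. ?f (flip i c)) = (\<Sum>v\<in>?W. card (dirs v) * ?f v)"
    by simp
  have "(\<Sum>c\<in>C. ?f c) = (\<Sum>v\<in>?W. of_bool (v \<in> C) * ?f v)"
    using code_in_space finite_hamming_space by (intro sum.mono_neutral_cong_left) auto
  then have "(\<Sum>c\<in>C. share c) = (\<Sum>v\<in>?W. of_bool (v \<in> C) * ?f v + card (dirs v) * ?f v)"
    unfolding share_def sum.distrib nbrs by simp
  also have "\<dots> = (\<Sum>v\<in>?W. 1)"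
  proof (rule sum.cong)
    fix v assume "v \<in> ?W"
    have "of_bool (v \<in> C) + real (card (dirs v)) = cov v" by (simp add: cov_def)
    then show "of_bool (v \<in> C) * ?f v + card (dirs v) * ?f v = 1"
      unfolding distrib_right[symmetric] using cov_pos[OF \<open>v \<in> ?W\<close>] by simp
  qed simp
  finally show ?thesis by (simp add: card_hamming_space)
qed

lemma loss_eq_sum_gain: "loss c = 3 / 2 - 1 / cov c + (\<Sum>i<n. gain c i)"
  by (simp add: loss_def share_def gain_def sum_subtractf add_divide_distrib)

lemma gain_heavy: "i \<in> heavy_dirs c \<Longrightarrow> 1 / 6 \<le> gain c i"
  by (simp add: heavy_dirs_def gain_def divide_simps)

lemma card_le_sum_gain:
  assumes "A \<subseteq> heavy_dirs c"
  shows "card A / 6 \<le> (\<Sum>i\<in>A. gain c i)"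
  using sum_bounded_below[of A "1 / 6" "gain c"] gain_heavy assms by auto

lemma loss_ge_cov:
  assumes code: "c \<in> C" and heavy: "A \<subseteq> heavy_dirs c"
  shows "1 - 1 / cov c + (if private_dirs c = {} then 1 / 2 else 0) + (\<Sum>i\<in>A. gain c i) \<le> loss c"
proof -
  let ?P = "private_dirs c"
  have private_less: "?P \<subseteq> {..<n}" by (auto simp: private_dirs_def)
  have "(\<Sum>i\<in>?P. gain c i) = - card ?P / 2"
    by (simp add: gain_def private_dirs_def)
  then have "(if ?P = {} then 1 / 2 else 0) - 1 / 2 \<le> (\<Sum>i\<in>?P. gain c i)"
    using card_private_dirs_le[OF code] by simp
  moreover have "(\<Sum>i\<in>A. gain c i) \<le> (\<Sum>i\<in>{..<n} - ?P. gain c i)"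
  proof (intro sum_mono2)
    show "A \<subseteq> {..<n} - ?P" using heavy by (auto simp: heavy_dirs_def private_dirs_def)
    show "0 \<le> gain c i" if "i \<in> ({..<n} - ?P) - A" for i
      using two_le_cov_flip[OF code, of i] that by (simp add: gain_def divide_simps)
  qed simp
  ultimately show ?thesis
    using sum.subset_diff[OF private_less finite_lessThan, of "gain c"]
    unfolding loss_eq_sum_gain by linarith
qed

lemma loss_ge:
  assumes code: "c \<in> C" and heavy: "A \<subseteq> heavy_dirs c"
  shows "(if dirs c = {} then 0 else 1 / 2) + (if private_dirs c = {} then 1 / 2 else 0)
    + (\<Sum>i\<in>A. gain c i) \<le> loss c"
proof -
  have "cov c = Suc (card (dirs c))" using code by (simp add: cov_def)
  moreover have "0 < card (dirs c)" if "dirs c \<noteq> {}" using that by (simp add: card_gt_0_iff)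
  ultimately have "(if dirs c = {} then 0 else 1 / 2) \<le> 1 - 1 / real (cov c)"
    by (cases "dirs c = {}") (simp_all add: divide_simps)
  then show ?thesis using loss_ge_cov[OF code heavy] by linarith
qed

lemma loss_ge_two_thirds:
  assumes code: "c \<in> C" and "3 \<le> n" and "dirs c \<noteq> {} \<or> private_dirs c = {}"
  shows "2 / 3 \<le> loss c"
proof (cases "2 \<le> card (dirs c)")
  case True
  then have "1 / real (cov c) \<le> 1 / 3"
    using code by (intro divide_left_mono) (auto simp: cov_def)
  then show ?thesis using loss_ge_cov[OF code empty_subsetI] by (simp split: if_splits)
next
  case False
  then have "heavy_dirs c \<noteq> {}"
    using sum_cov_heavy_dirs_ge[OF code] card_private_dirs_le[OF code] \<open>3 \<le> n\<close> by auto
  then have "1 \<le> card (heavy_dirs c)" by (simp add: Suc_le_eq card_gt_0_iff)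
  then have "1 / 6 \<le> (\<Sum>i\<in>heavy_dirs c. gain c i)"
    using card_le_sum_gain[OF order_refl, of c] by simp
  then show ?thesis using loss_ge[OF code order_refl] assms(3) by (auto split: if_splits)
qed

lemma sum_loss_eq: "(\<Sum>c\<in>C. loss c) = card C * (real n + 3) / 2 - 2 ^ n"
  by (simp add: loss_def sum_subtractf sum_share)

end

section \<open>Stars\<close>

locale ld_code_ge_6 = ld_code +
  assumes n_ge_6: "6 \<le> n"
begin

definition deficient :: "nat \<Rightarrow> nat \<Rightarrow> bool list \<Rightarrow> bool" where
  "deficient a j c \<longleftrightarrow> c \<in> C \<and> dirs c = {} \<and> private_dirs c = {a} \<and> heavy_dirs c = {j}"

definition star :: "nat \<Rightarrow> bool list \<Rightarrow> bool" where
  "star a u \<longleftrightarrow> u \<in> hamming_space n - C \<and> a < n \<and> dirs u = {..<n} - {a}"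

definition code_triple :: "bool list \<Rightarrow> nat \<Rightarrow> nat \<Rightarrow> nat \<Rightarrow> bool" where
  "code_triple u j k l \<longleftrightarrow> {j, k, l} \<subseteq> dirs u \<and> distinct [j, k, l] \<and> flip l (flip k (flip j u)) \<in> C"

lemma loss_ge_or_deficient:
  assumes code: "c \<in> C"
  shows "2 / 3 - 1 / (real n - 4) \<le> loss c \<or> (\<exists>a j. deficient a j c)"
proof (cases "dirs c \<noteq> {} \<or> private_dirs c = {}")
  case True
  have "0 \<le> 1 / (real n - 4)" using n_ge_6 by simp
  then show ?thesis using loss_ge_two_thirds[OF code _ True] n_ge_6 by linarith
next
  case False
  then obtain a where isolated: "dirs c = {}" "private_dirs c = {a}"
    using private_dirs_unique[OF code] by blast
  then have sum_cov: "n - 1 \<le> (\<Sum>j\<in>heavy_dirs c. cov (flip j c))"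
    using sum_cov_heavy_dirs_ge[OF code] by simp
  show ?thesis
  proof (cases "2 \<le> card (heavy_dirs c)")
    case True
    have "real n - 1 \<le> (\<Sum>j\<in>heavy_dirs c. real (cov (flip j c)))"
      using sum_cov n_ge_6 by (simp flip: of_nat_sum)
    then have "2 / 3 - 1 / (real n - 1 - 3) \<le> (\<Sum>j\<in>heavy_dirs c. gain c j)"
      unfolding gain_def
      using True n_ge_6 by (intro sum_half_minus_inverse_ge) (auto simp: heavy_dirs_def)
    then show ?thesis using loss_ge[OF code order_refl] isolated by simp
  next
    case False
    have "heavy_dirs c \<noteq> {}" using sum_cov n_ge_6 by auto
    then have "0 < card (heavy_dirs c)" by (simp add: card_gt_0_iff)
    then have "card (heavy_dirs c) = 1" using False by linarith
    then show ?thesis using isolated code by (auto simp: deficient_def card_1_singleton_iff)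
  qed
qed

lemma deficient_star:
  assumes "deficient a j c"
  shows "star a (flip j c)"
proof -
  have deficient: "c \<in> C" "dirs c = {}" "private_dirs c = {a}" "heavy_dirs c = {j}"
    using assms by (auto simp: deficient_def)
  have "a \<in> private_dirs c" "j \<in> heavy_dirs c" using deficient(3,4) by simp_all
  then have outer: "a < n" "dirs (flip a c) = {a}" and less_j: "j < n"
    using private_dirs_iff[OF deficient(1), of a] by (auto simp: heavy_dirs_def)
  have "j \<notin> dirs c" using deficient(2) by simp
  then have noncode: "flip j c \<notin> C" using less_j by (simp add: dirs_iff)
  have "j \<noteq> a"
    using \<open>a \<in> private_dirs c\<close> \<open>j \<in> heavy_dirs c\<close> by (auto simp: private_dirs_def heavy_dirs_def)
  then have "a \<notin> dirs (flip j c)" using outer less_j in_dirs_flip_commute[of a j c] by simp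
  then have "dirs (flip j c) \<subseteq> {..<n} - {a}" by (auto simp: dirs_iff)
  moreover have "card ({..<n} - {a}) \<le> card (dirs (flip j c))"
    using sum_cov_heavy_dirs_ge[OF deficient(1)] deficient(2-4) noncode outer(1)
    by (simp add: cov_noncode)
  ultimately have "dirs (flip j c) = {..<n} - {a}" by (intro card_seteq) auto
  then show ?thesis using outer(1) noncode code_in_space[OF deficient(1)] by (simp add: star_def)
qed

abbreviation star_gain :: real where
  "star_gain \<equiv> 1 / 2 - 1 / (real n - 1)"

lemma star_dirs: "star a u \<Longrightarrow> dirs u = {..<n} - {a}"
  by (simp add: star_def)

lemma star_center_noncode: "star a u \<Longrightarrow> u \<notin> C"
  by (simp add: star_def)

lemma star_cov: "star a u \<Longrightarrow> cov u = n - 1"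
  by (simp add: star_def cov_noncode)

lemma code_triple_swap:
  "code_triple u j k l \<Longrightarrow> code_triple u k j l"
  "code_triple u j k l \<Longrightarrow> code_triple u j l k"
  by (auto simp: code_triple_def flip_commute)

context
  fixes a u
  assumes star: "star a u"
begin

lemma star_pair_dirs: "j \<in> dirs u \<Longrightarrow> k \<in> dirs u \<Longrightarrow> {j, k} \<subseteq> dirs (flip k (flip j u))"
  by (auto simp: dirs_iff flip_commute[of j k])

lemma star_center_heavy: "j \<in> dirs u \<Longrightarrow> j \<in> heavy_dirs (flip j u)"
  using star_cov[OF star] n_ge_6 by (simp add: heavy_dirs_def dirs_iff)

lemma star_private_dirs:
  assumes member: "j \<in> dirs u"
  shows "private_dirs (flip j u) \<subseteq> {a}"
proof
  fix k assume priv: "k \<in> private_dirs (flip j u)"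
  then have "k < n" "dirs (flip k (flip j u)) = {k}"
    using private_dirs_iff[of "flip j u" k] member by (simp_all add: dirs_iff)
  moreover have "k \<noteq> j"
    using priv star_center_heavy[OF member] by (auto simp: private_dirs_def heavy_dirs_def)
  ultimately show "k \<in> {a}" using star_pair_dirs[OF member, of k] star_dirs[OF star] by auto
qed

lemma code_triple_heavy:
  assumes "code_triple u j k l"
  shows "k \<in> heavy_dirs (flip j u)"
proof (rule heavy_dirsI)
  show "{j, k, l} \<subseteq> dirs (flip k (flip j u))"
    using star_pair_dirs[of j k] assms by (auto simp: code_triple_def dirs_iff)
qed (use assms in \<open>auto simp: code_triple_def dirs_iff\<close>)

lemma star_loss_ge:
  assumes member: "j \<in> dirs u" and heavy: "A \<subseteq> heavy_dirs (flip j u) - {j}"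
  shows "star_gain + (if dirs (flip j u) = {} then 0 else 1 / 2)
    + (if private_dirs (flip j u) = {} then 1 / 2 else 0) + card A / 6 \<le> loss (flip j u)"
proof -
  have "finite A" using heavy finite_subset by fastforce
  then have "(\<Sum>i\<in>insert j A. gain (flip j u) i) = gain (flip j u) j + (\<Sum>i\<in>A. gain (flip j u) i)"
    using heavy by (intro sum.insert) auto
  moreover have "gain (flip j u) j = star_gain"
    using star_cov[OF star] n_ge_6 by (simp add: gain_def of_nat_diff)
  moreover have "card A / 6 \<le> (\<Sum>i\<in>A. gain (flip j u) i)"
    using heavy by (intro card_le_sum_gain) auto
  moreover have "insert j A \<subseteq> heavy_dirs (flip j u)"
    using heavy star_center_heavy[OF member] by blast
  moreover have "flip j u \<in> C" using member by (simp add: dirs_iff)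
  ultimately show ?thesis using loss_ge[of "flip j u" "insert j A"] by linarith
qed

lemma star_loss_ge_star_gain: "j \<in> dirs u \<Longrightarrow> star_gain \<le> loss (flip j u)"
  using star_loss_ge[of j "{}"] by (simp split: if_splits)

lemma star_loss_outer_code:
  assumes member: "j \<in> dirs u" and outer: "a \<in> dirs (flip j u)"
  shows "star_gain + 1 \<le> loss (flip j u)"
proof -
  have "a \<notin> private_dirs (flip j u)"
    using outer member private_dirs_iff[of "flip j u" a] by (simp add: dirs_iff)
  then have "private_dirs (flip j u) = {}" using star_private_dirs[OF member] by blast
  moreover have "dirs (flip j u) \<noteq> {}" using outer by blast
  ultimately show ?thesis using star_loss_ge[OF member, of "{}"] by simp
qed

lemma star_loss_not_private:
  assumes member: "j \<in> dirs u" and outer: "a \<notin> dirs (flip j u)" "a \<notin> private_dirs (flip j u)"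
  shows "star_gain + 2 / 3 \<le> loss (flip j u)"
proof -
  have "flip j u \<in> C" "a < n" using member star by (simp_all add: dirs_iff star_def)
  then obtain k where heavy: "k \<in> heavy_dirs (flip j u)" "a \<in> dirs (flip k (flip j u))"
    using heavy_dirs_cover[OF _ _ outer] by metis
  have "a \<notin> dirs u" using star_dirs[OF star] by simp
  then have "k \<noteq> j" using heavy(2) by force
  moreover have "private_dirs (flip j u) = {}" using star_private_dirs[OF member] outer(2) by blast
  ultimately show ?thesis
    using star_loss_ge[OF member, of "{k}"] heavy(1) by (simp split: if_splits)
qed

lemma star_loss_pair:
  assumes member: "j \<in> dirs u" and pair: "k \<in> dirs u" "k \<in> dirs (flip j u)"
  shows "star_gain + 2 / 3 \<le> loss (flip j u)"
proof -
  have "k \<noteq> j" using pair(2) star_center_noncode[OF star] by (auto simp: dirs_iff)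
  moreover have "k \<in> heavy_dirs (flip j u)"
    using star_pair_dirs[OF member pair(1)] pair(2) \<open>k \<noteq> j\<close> by (intro heavy_dirs_codeI) auto
  moreover have "dirs (flip j u) \<noteq> {}" using pair(2) by blast
  ultimately show ?thesis using star_loss_ge[OF member, of "{k}"] by (simp split: if_splits)
qed

lemma star_loss_triple:
  assumes triple: "code_triple u j k l"
  shows "star_gain + 1 / 3 \<le> loss (flip j u)"
proof -
  have "j \<in> dirs u" "{k, l} \<subseteq> heavy_dirs (flip j u) - {j}" "k \<noteq> l"
    using triple code_triple_heavy[OF triple] code_triple_heavy[OF code_triple_swap(2)[OF triple]]
    by (auto simp: code_triple_def)
  then show ?thesis using star_loss_ge[of j "{k, l}"] by (simp split: if_splits)
qed

lemma heavy_imp_code_triple: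
  assumes member: "j \<in> dirs u" and isolated: "dirs (flip j u) = {}" "private_dirs (flip j u) = {a}"
    and heavy: "k \<in> heavy_dirs (flip j u)" "k \<noteq> j"
  obtains l where "code_triple u j k l"
proof -
  let ?c = "flip j u"
  have cov_k: "k < n" "3 \<le> cov (flip k ?c)" using heavy(1) by (simp_all add: heavy_dirs_def)
  have "k \<notin> dirs ?c" using isolated(1) by simp
  then have "flip k ?c \<notin> C" using cov_k(1) by (simp add: dirs_iff)
  then have "\<not> dirs (flip k ?c) \<subseteq> {j, k}"
    using cov_k(2) heavy(2) card_mono[of "{j, k}" "dirs (flip k ?c)"] by (auto simp: cov_noncode)
  then obtain l where third: "l \<in> dirs (flip k ?c)" "l \<noteq> j" "l \<noteq> k" by blast
  have "a \<in> private_dirs ?c" using isolated(2) by simp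
  then have outer: "a < n" "dirs (flip a ?c) = {a}" "cov (flip a ?c) = 1"
    using member private_dirs_iff[of ?c a] by (simp_all add: dirs_iff private_dirs_def)
  have "k \<noteq> a" using outer(3) cov_k(2) by auto
  then have "l \<noteq> a" using third(1) outer(2) in_dirs_flip_commute[OF outer(1) cov_k(1)] by auto
  then have "code_triple u j k l"
    using member cov_k(1) third heavy(2) \<open>k \<noteq> a\<close> star_dirs[OF star]
    by (simp add: code_triple_def dirs_iff)
  then show ?thesis by (rule that)
qed

lemma star_loss_ge_or_triple:
  assumes member: "j \<in> dirs u" and not_deficient: "\<not> deficient a j (flip j u)"
  shows "star_gain + 2 / 3 \<le> loss (flip j u) \<or> (\<exists>k l. code_triple u j k l)"
proof (rule ccontr)
  let ?c = "flip j u"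
  assume "\<not> ?thesis"
  then have small: "loss ?c < star_gain + 2 / 3" and no_triple: "\<not> code_triple u j k l" for k l
    by auto
  have "a \<notin> dirs ?c" using star_loss_outer_code[OF member] small by auto
  moreover have "k \<notin> dirs ?c" if "k \<in> dirs u" for k
    using star_loss_pair[OF member that] small by auto
  ultimately have dirs: "dirs ?c = {}" using star_dirs[OF star] by (auto simp: dirs_def)
  then have "a \<in> private_dirs ?c" using star_loss_not_private[OF member] small by fastforce
  then have priv: "private_dirs ?c = {a}" using star_private_dirs[OF member] by blast
  have "heavy_dirs ?c = {j}"
    using heavy_imp_code_triple[OF member dirs priv] no_triple star_center_heavy[OF member] by blast
  then have "deficient a j ?c" using dirs priv member by (simp add: deficient_def dirs_iff)
  then show False using not_deficient by blast
qed

lemma star_not_deficient_loss: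
  assumes "j \<in> dirs u" "\<not> deficient a j (flip j u)"
  shows "star_gain + 1 / 3 \<le> loss (flip j u)"
  using star_loss_ge_or_triple[OF assms] star_loss_triple by fastforce

lemma star_sum_loss_ge:
  assumes "S \<subseteq> dirs u"
  shows "(real n - 3) / 2 + (\<Sum>i\<in>S. loss (flip i u) - star_gain) \<le> (\<Sum>i\<in>dirs u. loss (flip i u))"
proof -
  have "(\<Sum>i\<in>S. loss (flip i u) - star_gain) \<le> (\<Sum>i\<in>dirs u. loss (flip i u) - star_gain)"
    using assms star_loss_ge_star_gain by (intro sum_mono2) auto
  also have "\<dots> = (\<Sum>i\<in>dirs u. loss (flip i u)) - (real n - 1) * star_gain"
    using star n_ge_6 by (simp add: star_def sum_subtractf of_nat_diff)
  also have "(real n - 1) * star_gain = (real n - 3) / 2"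
    using n_ge_6 by (simp add: field_simps)
  finally show ?thesis by linarith
qed

lemma star_sum_loss_ge_not_deficient:
  assumes apex: "b \<in> dirs u" "flip a (flip b u) \<in> C"
    and not_deficient: "j \<in> dirs u" "j \<noteq> b" "\<not> deficient a j (flip j u)"
  shows "(real n - 3) / 2 + 5 / 3 \<le> (\<Sum>i\<in>dirs u. loss (flip i u))"
proof -
  have loss_b: "star_gain + 1 \<le> loss (flip b u)"
    using star_loss_outer_code[OF apex(1)] apex(2) star by (simp add: dirs_iff star_def)
  consider (single) "star_gain + 2 / 3 \<le> loss (flip j u)"
    | (triple) k l where "code_triple u j k l" "k \<noteq> b"
    using star_loss_ge_or_triple[OF not_deficient(1,3)] code_triple_swap(2)
    by (metis distinct_length_2_or_more code_triple_def)
  then show ?thesis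
  proof cases
    case single
    then show ?thesis using star_sum_loss_ge[of "{b, j}"] apex(1) loss_b not_deficient by auto
  next
    case (triple k l)
    then have "star_gain + 1 / 3 \<le> loss (flip j u)" "star_gain + 1 / 3 \<le> loss (flip k u)"
      using star_loss_triple code_triple_swap(1) by blast+
    moreover have "k \<in> dirs u" "k \<noteq> j" using triple by (auto simp: code_triple_def)
    ultimately show ?thesis
      using star_sum_loss_ge[of "{b, j, k}"] triple apex(1) loss_b not_deficient by auto
  qed
qed

end

section \<open>Hubs\<close>

definition hubs :: "bool list set" where
  "hubs = {v \<in> hamming_space n - C. n - 2 \<le> cov v}"

definition hub_dirs :: "bool list \<Rightarrow> nat set" where
  "hub_dirs c = {i. i < n \<and> flip i c \<in> hubs}"

lemma finite_hubs: "finite hubs"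
  using finite_hamming_space by (simp add: hubs_def)

lemma finite_hub_dirs [simp]: "finite (hub_dirs c)"
  by (simp add: hub_dirs_def)

lemma hub_dirs_subset_heavy: "hub_dirs c \<subseteq> heavy_dirs c"
  using n_ge_6 by (auto simp: hub_dirs_def hubs_def heavy_dirs_def)

lemma star_hub: "star a u \<Longrightarrow> u \<in> hubs"
  using star_cov[of a u] by (simp add: hubs_def star_def)

lemma star_hub_dirs: "star a u \<Longrightarrow> j \<in> dirs u \<Longrightarrow> j \<in> hub_dirs (flip j u)"
  using star_hub by (simp add: hub_dirs_def dirs_iff)

lemma deficient_hub_dirs:
  assumes "deficient a j c"
  shows "hub_dirs c = {j}"
proof -
  have heavy: "heavy_dirs c = {j}" using assms by (simp add: deficient_def)
  then have "j \<in> hub_dirs c"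
    using star_hub[OF deficient_star[OF assms]] by (auto simp: hub_dirs_def heavy_dirs_def)
  then show ?thesis using hub_dirs_subset_heavy[of c] heavy by blast
qed

lemma card_heavy_dirs_two_hubs:
  assumes code: "c \<in> C" and hubs: "i \<in> hub_dirs c" "j \<in> hub_dirs c" "i \<noteq> j"
  shows "n - 4 \<le> card (heavy_dirs c)"
proof -
  let ?I = "dirs (flip i c)" and ?J = "dirs (flip j c)"
  have less: "i < n" "j < n" using hubs by (auto simp: hub_dirs_def)
  have "?I \<inter> ?J \<subseteq> heavy_dirs c"
  proof
    fix k assume common: "k \<in> ?I \<inter> ?J"
    then have less_k: "k < n" by (simp add: dirs_iff)
    show "k \<in> heavy_dirs c"
    proof (cases "k = i \<or> k = j")
      case True
      then show ?thesis using hubs hub_dirs_subset_heavy by blast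
    next
      case False
      then show ?thesis
        using common less_k less hubs(3) self_in_dirs_flip[OF code less_k] in_dirs_flip_commute
        by (intro heavy_dirsI[of k k i j]) auto
    qed
  qed
  then have "card (?I \<inter> ?J) \<le> card (heavy_dirs c)" by (intro card_mono) auto
  moreover have "card ?I + card ?J = card (?I \<union> ?J) + card (?I \<inter> ?J)"
    by (rule card_Un_Int) auto
  moreover have "card (?I \<union> ?J) \<le> card {..<n}"
    by (rule card_mono) (auto simp: dirs_iff)
  moreover have "n - 2 \<le> card ?I" "n - 2 \<le> card ?J"
    using hubs by (auto simp: hub_dirs_def hubs_def cov_noncode)
  ultimately show ?thesis by simp
qed

lemma card_deficient_members_le:
  assumes star: "star a u" and shared: "j \<in> dirs u" "hub_dirs (flip j u) \<noteq> {j}"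
  shows "card {h \<in> dirs u. deficient a h (flip h u)} \<le> 2"
proof -
  obtain k where other: "k \<in> hub_dirs (flip j u)" "k \<noteq> j"
    using star_hub_dirs[OF star shared(1)] shared(2) by blast
  let ?v = "flip k (flip j u)"
  have hub: "k < n" "?v \<notin> C" "n - 2 \<le> cov ?v" using other by (auto simp: hub_dirs_def hubs_def)
  have less_j: "j < n" using shared(1) by (simp add: dirs_iff)
  have "{h \<in> dirs u. deficient a h (flip h u)} \<subseteq> {..<n} - dirs ?v"
  proof
    fix h assume "h \<in> {h \<in> dirs u. deficient a h (flip h u)}"
    then have member: "h < n" "h \<in> dirs u" "deficient a h (flip h u)" by (auto simp: dirs_iff)
    have neq: "h \<noteq> j" using deficient_hub_dirs[OF member(3)] shared(2) by auto
    then have light: "j \<notin> heavy_dirs (flip h u)" using member(3) by (simp add: deficient_def)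
    have "h \<notin> dirs ?v"
    proof
      assume nbr: "h \<in> dirs ?v"
      have "h \<noteq> k" using light less_j hub n_ge_6 by (auto simp: heavy_dirs_def flip_commute)
      moreover have "k \<in> dirs (flip j (flip h u))"
        using nbr hub(1) by (simp add: dirs_iff flip_commute)
      ultimately have "j \<in> heavy_dirs (flip h u)"
        using star_pair_dirs[OF star member(2) shared(1)] less_j neq other(2)
        by (intro heavy_dirsI[of j h j k]) auto
      then show False using light by blast
    qed
    then show "h \<in> {..<n} - dirs ?v" using member(1) by simp
  qed
  then have "card {h \<in> dirs u. deficient a h (flip h u)} \<le> card ({..<n} - dirs ?v)"
    by (intro card_mono) auto
  also have "\<dots> = n - card (dirs ?v)"
    by (subst card_Diff_subset) (auto simp: dirs_iff)
  also have "\<dots> \<le> 2" using hub by (simp add: cov_noncode)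
  finally show ?thesis .
qed

section \<open>Tight stars\<close>

abbreviation apex :: "nat \<Rightarrow> nat \<Rightarrow> bool list \<Rightarrow> bool list" where
  "apex a b u \<equiv> flip a (flip b u)"

definition tight :: "nat \<Rightarrow> nat \<Rightarrow> bool list \<Rightarrow> bool" where
  "tight a b u \<longleftrightarrow> star a u \<and> b \<in> dirs u \<and> apex a b u \<in> C \<and>
     (\<forall>j\<in>dirs u - {b}. deficient a j (flip j u))"

definition tight_stars :: "(nat \<times> nat \<times> bool list) set" where
  "tight_stars = {(a, b, u). tight a b u}"

definition apexes :: "bool list set" where
  "apexes = (\<lambda>(a, b, u). apex a b u) ` tight_stars"

definition second_centers :: "nat \<Rightarrow> nat \<Rightarrow> bool list \<Rightarrow> bool list set" where
  "second_centers a b u = {w. dirs w = {..<n} - {a, b} \<and> (\<exists>j<n. w = flip j (apex a b u))}"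

lemma flip_apex: "flip a (apex a b u) = flip b u" "flip b (apex a b u) = flip a u"
  by (simp_all add: flip_commute[of b a])

lemma star_sum_loss_ge_not_tight:
  assumes star: "star a u" and not_tight: "\<forall>b. \<not> tight a b u"
  shows "(real n - 3) / 2 + 5 / 3 \<le> (\<Sum>i\<in>dirs u. loss (flip i u))"
proof -
  have "a \<notin> dirs u" "a < n" "u \<notin> C" and word: "u \<in> hamming_space n"
    using star by (simp_all add: star_def)
  then have "flip a u \<notin> C" by (simp add: dirs_iff)
  then have "dirs (flip a u) \<noteq> {}"
    using cov_pos[of "flip a u"] word by (auto simp: cov_noncode)
  then obtain b where nbr: "b < n" "flip b (flip a u) \<in> C" using dirs_iff by blast
  then have "b \<noteq> a" using \<open>u \<notin> C\<close> by auto
  then have apex: "b \<in> dirs u" "apex a b u \<in> C"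
    using nbr star_dirs[OF star] by (simp_all add: flip_commute)
  then obtain j where "j \<in> dirs u" "j \<noteq> b" "\<not> deficient a j (flip j u)"
    using not_tight star by (auto simp: tight_def)
  then show ?thesis using star_sum_loss_ge_not_deficient[OF star apex] by blast
qed

context
  fixes a b u
  assumes tight: "tight a b u"
begin

lemma tight_star: "star a u"
  and tight_dir: "b \<in> dirs u"
  and apex_code: "apex a b u \<in> C"
  and tight_deficient: "j \<in> dirs u - {b} \<Longrightarrow> deficient a j (flip j u)"
  using tight by (simp_all add: tight_def)

lemma tight_dirs_less: "a < n" "b < n" and tight_dirs_neq: "a \<noteq> b"
  using tight_star tight_dir by (auto simp: star_def)

lemma tight_member_dirs: "k \<in> dirs u - {b} \<Longrightarrow> dirs (flip k u) = {}"
  using tight_deficient by (simp add: deficient_def)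

lemma tight_pair_notin:
  assumes "k \<in> dirs u - {b}" "l < n"
  shows "flip k (flip l u) \<notin> C"
proof -
  have "l \<notin> dirs (flip k u)" using tight_member_dirs[OF assms(1)] by simp
  then show ?thesis using assms(2) by (simp add: dirs_iff flip_commute)
qed

lemma tight_triple_outer_notin:
  assumes member: "k \<in> dirs u - {b}" and other: "l < n" "l \<noteq> a"
  shows "flip l (flip k (flip a u)) \<notin> C"
proof -
  have "a \<in> private_dirs (flip k u)" "flip k u \<in> C"
    using tight_deficient[OF member] by (simp_all add: deficient_def)
  then have "l \<notin> dirs (flip a (flip k u))" using private_dirs_iff other(2) by simp
  then show ?thesis using other(1) by (simp add: dirs_iff flip_commute)
qed

lemma tight_triple_notin:
  assumes member_k: "k \<in> dirs u - {b}" and member_l: "l \<in> dirs u - {b}" and "k \<noteq> l"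
  shows "flip l (flip k (flip b u)) \<notin> C"
proof
  assume "flip l (flip k (flip b u)) \<in> C"
  then have "code_triple u k l b"
    using member_k member_l \<open>k \<noteq> l\<close> tight_dir by (auto simp: code_triple_def flip_commute)
  then have "l \<in> heavy_dirs (flip k u)" by (rule code_triple_heavy[OF tight_star])
  then show False using tight_deficient[OF member_k] \<open>k \<noteq> l\<close> by (simp add: deficient_def)
qed

lemma tight_outer: "flip a u \<notin> C" "dirs (flip a u) = {b}"
proof -
  have "a \<notin> dirs u" using star_dirs[OF tight_star] by simp
  then show "flip a u \<notin> C" using tight_dirs_less(1) by (simp add: dirs_iff)
  have "k = b" if "k \<in> dirs (flip a u)" for k
  proof (rule ccontr)
    assume "k \<noteq> b"
    have code_nbr: "k < n" "flip k (flip a u) \<in> C" using that by (simp_all add: dirs_iff)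
    then have "k \<noteq> a" using star_center_noncode[OF tight_star] by auto
    then have "k \<in> dirs u - {b}" using code_nbr(1) \<open>k \<noteq> b\<close> star_dirs[OF tight_star] by simp
    then show False using tight_pair_notin[OF _ tight_dirs_less(1)] code_nbr(2) by blast
  qed
  moreover have "b \<in> dirs (flip a u)"
    using apex_code tight_dirs_less(2) by (simp add: dirs_iff flip_commute)
  ultimately show "dirs (flip a u) = {b}" by blast
qed

lemma cov_tight_dir_le: "cov (flip b u) \<le> 2"
proof -
  have "k = a" if "k \<in> dirs (flip b u)" for k
  proof (rule ccontr)
    assume "k \<noteq> a"
    have code_nbr: "k < n" "flip k (flip b u) \<in> C" using that by (simp_all add: dirs_iff)
    then have "k \<noteq> b" using star_center_noncode[OF tight_star] by auto
    then have "k \<in> dirs u - {b}" using code_nbr(1) \<open>k \<noteq> a\<close> star_dirs[OF tight_star] by simp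
    then show False using tight_pair_notin[OF _ tight_dirs_less(2)] code_nbr(2) by blast
  qed
  then have "dirs (flip b u) \<subseteq> {a}" by blast
  then show ?thesis using card_mono[of "{a}" "dirs (flip b u)"] by (simp add: cov_def)
qed

lemma apex_dirs: "dirs (apex a b u) = {a}"
proof -
  have "k = a" if "k \<in> dirs (apex a b u)" for k
  proof (rule ccontr)
    assume "k \<noteq> a"
    have code_nbr: "k < n" "flip k (apex a b u) \<in> C" using that by (simp_all add: dirs_iff)
    then have "k \<noteq> b" using flip_apex(2) tight_outer(1) by auto
    then have "k \<in> dirs u - {b}" using code_nbr(1) \<open>k \<noteq> a\<close> star_dirs[OF tight_star] by simp
    then have "flip b (flip k (flip a u)) \<notin> C"
      using tight_triple_outer_notin[OF _ tight_dirs_less(2)] tight_dirs_neq by blast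
    then show False using code_nbr(2) by (simp add: flip_commute)
  qed
  moreover have "a \<in> dirs (apex a b u)"
    using tight_dir tight_dirs_less(1) by (simp add: dirs_iff)
  ultimately show ?thesis by blast
qed

lemma apex_private_dirs: "private_dirs (apex a b u) = {b}"
proof -
  have "b \<in> private_dirs (apex a b u)"
    using private_dirs_iff[OF apex_code] tight_outer tight_dirs_less(2) flip_apex(2) by simp
  then show ?thesis using private_dirs_unique[OF apex_code] by blast
qed

lemma apex_nbr_noncode:
  assumes "k \<in> dirs u - {b}"
  shows "flip k (apex a b u) \<notin> C"
proof -
  have "k \<notin> dirs (apex a b u)" using apex_dirs star_dirs[OF tight_star] assms by simp
  then show ?thesis using assms by (simp add: dirs_iff)
qed

lemma apex_nbr_dirs:
  assumes member: "k \<in> dirs u - {b}"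
  shows "dirs (flip k (apex a b u)) \<subseteq> {..<n} - {a, b}"
proof -
  have "flip a (flip k (apex a b u)) = flip k (flip b u)"
    "flip b (flip k (apex a b u)) = flip k (flip a u)"
    by (simp_all add: flip_commute[of a k] flip_commute[of b k] flip_apex(2))
  then have "a \<notin> dirs (flip k (apex a b u))" "b \<notin> dirs (flip k (apex a b u))"
    using tight_pair_notin[OF member] tight_dirs_less by (simp_all add: dirs_iff)
  then show ?thesis by (auto simp: dirs_def)
qed

lemma cov_apex_nbr_le:
  assumes "k < n" "flip k (apex a b u) \<notin> C"
  shows "cov (flip k (apex a b u)) \<le> n - 2"
proof (cases "k = b")
  case True
  then show ?thesis using tight_outer n_ge_6 flip_apex(2) by (simp add: cov_noncode)
next
  case False
  have "k \<noteq> a" using assms(2) apex_dirs dirs_iff[of a "apex a b u"] by auto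
  then have "k \<in> dirs u - {b}" using assms(1) False star_dirs[OF tight_star] by simp
  then have "card (dirs (flip k (apex a b u))) \<le> card ({..<n} - {a, b})"
    by (intro card_mono apex_nbr_dirs) auto
  then show ?thesis
    using assms(2) tight_dirs_less tight_dirs_neq by (simp add: cov_noncode card_Diff_subset)
qed

lemma second_centerE:
  assumes "w \<in> second_centers a b u"
  obtains j where "j \<in> dirs u - {b}" "w = flip j (apex a b u)" "dirs w = {..<n} - {a, b}"
proof -
  obtain j where center: "j < n" "w = flip j (apex a b u)" "dirs w = {..<n} - {a, b}"
    using assms by (auto simp: second_centers_def)
  have "j \<in> dirs w" using self_in_dirs_flip[OF apex_code center(1)] unfolding center(2) .
  then have "j \<in> dirs u - {b}" unfolding center(3) star_dirs[OF tight_star] by blast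
  then show ?thesis using center(2,3) by (rule that)
qed

lemma second_center_hub:
  assumes "w \<in> second_centers a b u"
  shows "w \<in> hubs" "cov w = n - 2"
proof -
  obtain j where center: "j \<in> dirs u - {b}" "w = flip j (apex a b u)" "dirs w = {..<n} - {a, b}"
    using assms by (rule second_centerE)
  have "w \<notin> C" using center apex_nbr_noncode by simp
  then show "cov w = n - 2"
    using center(3) tight_dirs_less tight_dirs_neq by (simp add: cov_noncode card_Diff_subset)
  then show "w \<in> hubs" using \<open>w \<notin> C\<close> center(2) code_in_space[OF apex_code] by (simp add: hubs_def)
qed

lemma heavy_dir_second_center:
  assumes "heavy_dirs (apex a b u) = {j}"
  shows "flip j (apex a b u) \<in> second_centers a b u"
proof -
  let ?c = "apex a b u"
  have "j \<in> heavy_dirs ?c" using assms by simp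
  then have heavy: "j < n" "3 \<le> cov (flip j ?c)" by (simp_all add: heavy_dirs_def)
  have "j \<noteq> a" using heavy(2) cov_tight_dir_le flip_apex(1) by auto
  moreover have "j \<noteq> b" using heavy(2) tight_outer flip_apex(2) by (auto simp: cov_noncode)
  ultimately have member: "j \<in> dirs u - {b}" using heavy(1) star_dirs[OF tight_star] by simp
  have "n - 2 \<le> cov (flip j ?c)"
    using sum_cov_heavy_dirs_ge[OF apex_code] assms apex_dirs apex_private_dirs by simp
  then have "card ({..<n} - {a, b}) \<le> card (dirs (flip j ?c))"
    using apex_nbr_noncode[OF member] tight_dirs_less tight_dirs_neq
    by (simp add: cov_noncode card_Diff_subset)
  then have "dirs (flip j ?c) = {..<n} - {a, b}"
    using apex_nbr_dirs[OF member] by (intro card_seteq) auto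
  then show ?thesis using heavy(1) by (auto simp: second_centers_def)
qed

lemma apex_loss_ge_sum_gain:
  "A \<subseteq> heavy_dirs (apex a b u) \<Longrightarrow> 1 / 2 + (\<Sum>i\<in>A. gain (apex a b u) i) \<le> loss (apex a b u)"
  using loss_ge[OF apex_code] apex_dirs apex_private_dirs by simp

lemma apex_loss_ge_second_center:
  assumes "w \<in> second_centers a b u"
  shows "1 - 1 / (real n - 2) \<le> loss (apex a b u)"
proof -
  obtain j where center: "j \<in> dirs u - {b}" "w = flip j (apex a b u)"
    using assms by (rule second_centerE)
  then have "cov (flip j (apex a b u)) = n - 2" using second_center_hub(2)[OF assms] by simp
  then have "j \<in> heavy_dirs (apex a b u)" "gain (apex a b u) j = 1 / 2 - 1 / (real n - 2)"
    using center(1) n_ge_6 by (simp_all add: heavy_dirs_def gain_def of_nat_diff dirs_iff)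
  then show ?thesis using apex_loss_ge_sum_gain[of "{j}"] by simp
qed

lemma apex_loss_ge_no_second_center:
  assumes "second_centers a b u = {}"
  shows "7 / 6 - 1 / (real n - 5) \<le> loss (apex a b u)"
proof -
  let ?H = "heavy_dirs (apex a b u)"
  have sum_cov: "n - 2 \<le> (\<Sum>j\<in>?H. cov (flip j (apex a b u)))"
    using sum_cov_heavy_dirs_ge[OF apex_code] apex_dirs apex_private_dirs by simp
  have "card ?H \<noteq> 0" using sum_cov n_ge_6 by auto
  moreover have "card ?H \<noteq> 1"
    using heavy_dir_second_center assms by (auto simp: card_1_singleton_iff)
  ultimately have "2 \<le> card ?H" by linarith
  moreover have "real n - 2 \<le> (\<Sum>j\<in>?H. real (cov (flip j (apex a b u))))"
    using sum_cov n_ge_6 by (simp flip: of_nat_sum)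
  ultimately have "2 / 3 - 1 / (real n - 2 - 3) \<le> (\<Sum>j\<in>?H. gain (apex a b u) j)"
    unfolding gain_def
    using n_ge_6 by (intro sum_half_minus_inverse_ge) (auto simp: heavy_dirs_def)
  then show ?thesis using apex_loss_ge_sum_gain[OF order_refl] by simp
qed

lemma second_member_nbrs:
  assumes center: "w \<in> second_centers a b u" and member: "k \<in> dirs w" "flip k w \<noteq> apex a b u"
  shows "flip a (flip k w) \<notin> C" "flip b (flip k w) \<notin> C"
proof -
  obtain j where center_eq: "j \<in> dirs u - {b}" "w = flip j (apex a b u)" "dirs w = {..<n} - {a, b}"
    using center by (rule second_centerE)
  have dir: "k \<in> dirs u - {b}"
    using member(1) unfolding center_eq(3) star_dirs[OF tight_star] by blast
  have "k \<noteq> j" using member(2) center_eq(2) by auto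
  have "flip a (flip k w) = flip k (flip j (flip b u))"
    unfolding center_eq(2) by (simp add: flip_commute[of a k] flip_commute[of a j])
  then show "flip a (flip k w) \<notin> C" using tight_triple_notin[OF center_eq(1) dir] \<open>k \<noteq> j\<close> by simp
  have "flip b (flip k w) = flip k (flip j (flip a u))"
    unfolding center_eq(2) by (simp add: flip_commute[of b k] flip_commute[of b j] flip_apex(2))
  then show "flip b (flip k w) \<notin> C"
    using tight_triple_outer_notin[OF center_eq(1), of k] dir star_dirs[OF tight_star] by simp
qed

lemma second_member_loss:
  assumes center: "w \<in> second_centers a b u" and member: "k \<in> dirs w" "flip k w \<noteq> apex a b u"
  shows "2 / 3 - 1 / (real n - 2) \<le> loss (flip k w)"
proof -
  have code: "flip k w \<in> C" and less_k: "k < n" using member(1) by (simp_all add: dirs_iff)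
  have w_dirs: "dirs w = {..<n} - {a, b}" using center by (rule second_centerE)
  obtain y where not_private: "y \<in> {a, b}" "y \<notin> private_dirs (flip k w)"
    using private_dirs_unique[OF code] tight_dirs_neq by blast
  then have "y < n" "y \<notin> dirs (flip k w)"
    using tight_dirs_less second_member_nbrs[OF assms] by (auto simp: dirs_iff)
  then obtain l where heavy: "l \<in> heavy_dirs (flip k w)" "y \<in> dirs (flip l (flip k w))"
    using heavy_dirs_cover[OF code _ _ not_private(2)] by blast
  have "y \<notin> dirs w" using not_private(1) w_dirs by blast
  then have "l \<noteq> k" using heavy(2) by force
  have cov_center: "cov w = n - 2" by (rule second_center_hub(2)[OF center])
  have "{k, l} \<subseteq> heavy_dirs (flip k w)"
    using heavy(1) cov_center less_k n_ge_6 by (simp add: heavy_dirs_def)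
  then have "(\<Sum>i\<in>{k, l}. gain (flip k w) i) \<le> loss (flip k w)"
    using loss_ge[OF code, of "{k, l}"] by (simp split: if_splits)
  moreover have "gain (flip k w) k = 1 / 2 - 1 / (real n - 2)"
    using cov_center n_ge_6 by (simp add: gain_def of_nat_diff)
  ultimately show ?thesis using gain_heavy[OF heavy(1)] \<open>l \<noteq> k\<close> by simp
qed

lemma tight_sum_loss_ge: "(real n - 1) / 2 \<le> (\<Sum>i\<in>dirs u. loss (flip i u))"
proof -
  have "a \<in> dirs (flip b u)" using apex_code tight_dirs_less(1) by (simp add: dirs_iff)
  then have "star_gain + 1 \<le> loss (flip b u)"
    by (rule star_loss_outer_code[OF tight_star tight_dir])
  then show ?thesis
    using star_sum_loss_ge[OF tight_star, of "{b}"] tight_dir by (simp add: field_simps)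
qed

lemma tight_hub_dirs:
  assumes "i \<in> dirs u"
  shows "hub_dirs (flip i u) = {i}"
proof (rule ccontr)
  assume "hub_dirs (flip i u) \<noteq> {i}"
  then have "card {h \<in> dirs u. deficient a h (flip h u)} \<le> 2"
    using card_deficient_members_le[OF tight_star assms] by blast
  moreover have "card (dirs u - {b}) \<le> card {h \<in> dirs u. deficient a h (flip h u)}"
    using tight_deficient by (intro card_mono) auto
  moreover have "card (dirs u - {b}) = n - 2"
    using tight_dir star_cov[OF tight_star] tight_star by (simp add: star_def cov_noncode)
  ultimately show False using n_ge_6 by linarith
qed

end

lemma apex_inj:
  assumes tight: "tight a b u" "tight a' b' u'" and eq: "apex a b u = apex a' b' u'"
  shows "a = a'" "b = b'" "u = u'"
proof -
  show eq_a: "a = a'" using apex_dirs[OF tight(1)] apex_dirs[OF tight(2)] eq by simp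
  show eq_b: "b = b'" using apex_private_dirs[OF tight(1)] apex_private_dirs[OF tight(2)] eq by simp
  show "u = u'" using eq eq_a eq_b by (metis flip_flip)
qed

lemma tight_center_inj:
  assumes tight: "tight a b u" "tight a' b' u"
  shows "a = a'" "b = b'"
proof -
  have "{..<n} - {a} = {..<n} - {a'}"
    using star_dirs[OF tight_star[OF tight(1)]] star_dirs[OF tight_star[OF tight(2)]] by simp
  then show eq_a: "a = a'"
    using tight_dirs_less(1)[OF tight(1)] tight_dirs_less(1)[OF tight(2)] by blast
  show "b = b'" using tight_outer(2)[OF tight(1)] tight_outer(2)[OF tight(2)] eq_a by simp
qed

lemma apexE:
  assumes "c \<in> apexes"
  obtains a b u where "tight a b u" "c = apex a b u"
  using assms by (auto simp: apexes_def tight_stars_def)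

lemma apexI: "tight a b u \<Longrightarrow> apex a b u \<in> apexes"
  by (force simp: apexes_def tight_stars_def)

lemma star_member_not_apex:
  assumes star: "star a u" and member: "j \<in> dirs u"
  shows "flip j u \<notin> apexes"
proof
  assume "flip j u \<in> apexes"
  then obtain a' b' u' where tight: "tight a' b' u'" and eq: "flip j u = apex a' b' u'"
    by (rule apexE)
  have "u = flip j (apex a' b' u')" by (simp flip: eq)
  then have "cov u \<le> n - 2"
    using cov_apex_nbr_le[OF tight, of j] member star by (simp add: dirs_iff star_def)
  then show False using star_cov[OF star] n_ge_6 by simp
qed

lemma second_member_apex_iff:
  assumes tight: "tight a b u" and center: "w \<in> second_centers a b u" and member: "k \<in> dirs w"
  shows "flip k w \<in> apexes \<longleftrightarrow> flip k w = apex a b u"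
proof
  assume "flip k w = apex a b u"
  then show "flip k w \<in> apexes" using apexI[OF tight] by simp
next
  assume "flip k w \<in> apexes"
  then obtain a' b' u' where tight': "tight a' b' u'" and eq: "flip k w = apex a' b' u'"
    by (rule apexE)
  have center_eq: "w = flip k (apex a' b' u')" by (simp flip: eq)
  have hub: "w \<notin> C" "cov w = n - 2"
    using second_center_hub[OF tight center] by (simp_all add: hubs_def)
  have code: "flip a' (flip k w) \<in> C"
    using eq flip_apex(1) tight_dir[OF tight'] by (simp add: dirs_iff)
  have "k \<noteq> a'" using code hub(1) by auto
  moreover have "k \<noteq> b'"
    using hub(2) center_eq flip_apex(2) tight_outer[OF tight'] n_ge_6 by (auto simp: cov_noncode)
  ultimately have "k \<in> dirs u' - {b'}"
    using member star_dirs[OF tight_star[OF tight']] by (simp add: dirs_iff)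
  then have "a' \<notin> dirs w" using apex_nbr_dirs[OF tight'] center_eq by blast
  then have "a' \<in> {a, b}"
    using center tight_dirs_less(1)[OF tight'] by (auto simp: second_centers_def)
  then show "flip k w = apex a b u" using second_member_nbrs[OF tight center member] code by blast
qed

lemma second_center_inj:
  assumes tight: "tight a b u" "tight a' b' u'"
    and center: "w \<in> second_centers a b u" "w \<in> second_centers a' b' u'"
  shows "a = a'" "b = b'" "u = u'"
proof -
  obtain j where nbr: "w = flip j (apex a' b' u')" "j < n"
    using center(2) by (auto simp: second_centers_def)
  then have "flip j w = apex a' b' u'" by simp
  moreover from this have "flip j w \<in> apexes" "j \<in> dirs w"
    using apexI[OF tight(2)] apex_code[OF tight(2)] nbr(2) by (simp_all add: dirs_iff)
  ultimately have "apex a b u = apex a' b' u'"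
    using second_member_apex_iff[OF tight(1) center(1), of j] by simp
  then show "a = a'" "b = b'" "u = u'" using apex_inj[OF tight] by blast+
qed

end

section \<open>Discharging\<close>

locale ld_code_threshold = ld_code +
  fixes \<theta> :: real
  assumes n_ge_11: "11 \<le> n"
    and \<theta>_le: "\<theta> \<le> 2 / 3 - 1 / (real n - 4)"
    and \<theta>_le_average: "real n * (\<theta> - 1 / 2) \<le> 2 / 3 - 1 / (real n - 5)"

sublocale ld_code_threshold \<subseteq> ld_code_ge_6
  using n_ge_11 by unfold_locales simp

context ld_code_threshold
begin

text \<open>Every codeword that is not an apex pays its hubs, whereas the surplus of an apex is kept for
  its \<open>cluster\<close>.  The rate \<open>1 / 20\<close> is affordable since a hub has gain at least
  \<open>1 / 2 - 1 / 9 > 1 / 6 + 1 / 20\<close>.\<close>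

definition pay :: "bool list \<Rightarrow> real" where
  "pay c = (if card (hub_dirs c) = 1 then loss c - \<theta> else 1 / 20)"

definition receipt :: "bool list \<Rightarrow> real" where
  "receipt v = (\<Sum>i | i \<in> dirs v \<and> flip i v \<notin> apexes. pay (flip i v))"

definition cluster :: "nat \<times> nat \<times> bool list \<Rightarrow> bool list set" where
  "cluster = (\<lambda>(a, b, u). insert u (second_centers a b u))"

lemma \<theta>_le_two_thirds: "\<theta> \<le> 2 / 3"
proof -
  have "0 \<le> 1 / (real n - 4)" using n_ge_11 by simp
  then show ?thesis using \<theta>_le by linarith
qed

lemma mult_\<theta>_le:
  assumes "0 \<le> m" "m \<le> real n"
  shows "m * (\<theta> - 1 / 2) \<le> 2 / 3"
proof (cases "\<theta> \<le> 1 / 2")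
  case True
  then have "m * (\<theta> - 1 / 2) \<le> 0" using assms by (intro mult_nonneg_nonpos) auto
  then show ?thesis by linarith
next
  case False
  then have "m * (\<theta> - 1 / 2) \<le> real n * (\<theta> - 1 / 2)" using assms by (intro mult_right_mono) auto
  moreover have "0 \<le> 1 / (real n - 5)" using n_ge_11 by simp
  ultimately show ?thesis using \<theta>_le_average by linarith
qed

text \<open>All members of a second star but the apex can spare \<open>1 / 60\<close>, which makes up for the missing
  \<open>1 / 6\<close> from \<open>n = 13\<close> on.  Up to \<open>n = 12\<close> both consequences below come from the first bound on
  \<open>\<theta>\<close>.\<close>

lemma \<theta>_le_second_member: "\<theta> + 1 / 60 \<le> 2 / 3 - 1 / (real n - 2)"
proof -
  consider (eleven) "n = 11" | (twelve) "n = 12" | (large) "13 \<le> n" using n_ge_11 by linarith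
  then show ?thesis
  proof cases
    case large
    then have "13 * (\<theta> - 1 / 2) \<le> 2 / 3" by (intro mult_\<theta>_le) auto
    then have "\<theta> \<le> 1 / 2 + 2 / 39" by simp
    moreover have "1 / (real n - 2) \<le> 1 / 11" using large by (intro divide_left_mono) auto
    ultimately show ?thesis by linarith
  qed (use \<theta>_le in auto)
qed

lemma \<theta>_le_average_second:
  "real n * (\<theta> - 1 / 2) + 1 / (real n - 2) \<le> 1 / 2 + (real n - 3) / 60"
proof -
  consider (eleven) "n = 11" | (twelve) "n = 12" | (large) "13 \<le> n" using n_ge_11 by linarith
  then show ?thesis
  proof cases
    case large
    then have "1 / (real n - 2) \<le> 1 / (real n - 5)" by (intro divide_left_mono) auto
    moreover have "10 / 60 \<le> (real n - 3) / 60" using large by simp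
    ultimately show ?thesis using \<theta>_le_average by linarith
  qed (use \<theta>_le in auto)
qed

lemma loss_ge_two_hubs:
  assumes code: "c \<in> C" and two_hubs: "2 \<le> card (hub_dirs c)"
  shows "\<theta> + card (hub_dirs c) / 20 \<le> loss c"
proof -
  let ?B = "hub_dirs c" and ?H = "heavy_dirs c"
  have "1 / 6 + 1 / 20 \<le> gain c i" if "i \<in> ?B" for i
  proof -
    have "9 \<le> cov (flip i c)" using that n_ge_11 by (auto simp: hub_dirs_def hubs_def)
    then show ?thesis by (simp add: gain_def divide_simps)
  qed
  then have "card ?B * (1 / 6 + 1 / 20) \<le> (\<Sum>i\<in>?B. gain c i)"
    by (intro sum_bounded_below) auto
  moreover have "card (?H - ?B) / 6 \<le> (\<Sum>i\<in>?H - ?B. gain c i)"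
    by (intro card_le_sum_gain) auto
  moreover have "card (?H - ?B) = real (card ?H) - card ?B"
    using hub_dirs_subset_heavy[of c] by (simp add: card_Diff_subset card_mono of_nat_diff)
  moreover obtain i j where "i \<in> ?B" "j \<in> ?B" "i \<noteq> j"
    using two_hubs card_le_Suc0_iff_eq[of ?B] by fastforce
  then have "n - 4 \<le> card ?H" by (rule card_heavy_dirs_two_hubs[OF code])
  then have "7 \<le> real (card ?H)" using n_ge_11 by linarith
  moreover have "(\<Sum>i\<in>?H. gain c i) \<le> loss c"
    using loss_ge[OF code order_refl] by (simp split: if_splits)
  ultimately show ?thesis
    using sum.subset_diff[OF hub_dirs_subset_heavy finite_heavy_dirs, of "gain c" c]
      \<theta>_le_two_thirds by (simp add: field_simps)
qed

lemma \<theta>_le_loss: "c \<in> C \<Longrightarrow> \<forall>a j. \<not> deficient a j c \<Longrightarrow> \<theta> \<le> loss c"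
  using loss_ge_or_deficient \<theta>_le by force

lemma hub_pay_le:
  assumes code: "c \<in> C"
  shows "card (hub_dirs c) * pay c \<le> loss c - \<theta>"
proof -
  consider (none) "hub_dirs c = {}" | (one) "card (hub_dirs c) = 1" | (many) "2 \<le> card (hub_dirs c)"
    using card_0_eq[OF finite_hub_dirs, of c] by linarith
  then show ?thesis
  proof cases
    case none
    then have "\<not> deficient a j c" for a j using deficient_hub_dirs by blast
    then show ?thesis using \<theta>_le_loss[OF code] none by simp
  next
    case one
    then show ?thesis by (simp add: pay_def)
  next
    case many
    then show ?thesis using loss_ge_two_hubs[OF code] by (simp add: pay_def)
  qed
qed

lemma sum_receipt:
  "(\<Sum>v\<in>hubs. receipt v) = (\<Sum>c\<in>C - apexes. card (hub_dirs c) * pay c)"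
proof -
  have "(\<Sum>c\<in>C - apexes. \<Sum>i | i < n \<and> flip i c \<in> hubs. pay c)
      = (\<Sum>v\<in>hubs. \<Sum>i | i < n \<and> flip i v \<in> C - apexes. pay (flip i v))"
    using finite_code finite_hubs by (intro sum_flip_swap) auto
  then show ?thesis by (simp add: receipt_def hub_dirs_def dirs_iff conj_assoc)
qed

lemma receipt_star:
  assumes "star a u"
  shows "receipt u = (\<Sum>i\<in>dirs u. pay (flip i u))"
  unfolding receipt_def using star_member_not_apex[OF assms] by (intro sum.cong) auto

lemma receipt_star_unshared:
  assumes star: "star a u" and unshared: "\<forall>i\<in>dirs u. hub_dirs (flip i u) = {i}"
  shows "receipt u = (\<Sum>i\<in>dirs u. loss (flip i u)) - (real n - 1) * \<theta>"
proof -
  have "receipt u = (\<Sum>i\<in>dirs u. loss (flip i u) - \<theta>)"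
    unfolding receipt_star[OF star] using unshared by (intro sum.cong) (auto simp: pay_def)
  then show ?thesis
    using star n_ge_11 by (simp add: star_def sum_subtractf of_nat_diff)
qed

lemma receipt_star_shared:
  assumes star: "star a u" and shared: "j \<in> dirs u" "hub_dirs (flip j u) \<noteq> {j}"
  shows "0 \<le> receipt u"
proof -
  let ?D = "{h \<in> dirs u. deficient a h (flip h u)}"
  have "1 / (real n - 1) \<le> 1 / (real n - 4)" using n_ge_11 by (intro divide_left_mono) auto
  then have \<theta>_le_star_gain: "\<theta> - 1 / 6 \<le> star_gain" using \<theta>_le by linarith
  have "- (1 / 6) \<le> pay (flip i u)" if "i \<in> ?D" for i
    using star_loss_ge_star_gain[OF star, of i] that \<theta>_le_star_gain by (auto simp: pay_def)
  then have "card ?D * (- (1 / 6)) \<le> (\<Sum>i\<in>?D. pay (flip i u))"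
    by (intro sum_bounded_below) auto
  moreover have "1 / 20 \<le> pay (flip i u)" if "i \<in> dirs u - ?D" for i
    using star_not_deficient_loss[OF star, of i] that \<theta>_le_star_gain by (auto simp: pay_def)
  then have "card (dirs u - ?D) * (1 / 20) \<le> (\<Sum>i\<in>dirs u - ?D. pay (flip i u))"
    by (intro sum_bounded_below) auto
  moreover have "card ?D \<le> 2" using card_deficient_members_le[OF star shared] .
  moreover have "real (card (dirs u - ?D)) = real n - 1 - card ?D"
  proof -
    have "card (dirs u) = n - 1" using star by (simp add: star_def)
    moreover have "card (dirs u - ?D) = card (dirs u) - card ?D" by (rule card_Diff_subset) auto
    ultimately show ?thesis using \<open>card ?D \<le> 2\<close> n_ge_11 by (simp add: of_nat_diff)
  qed
  moreover have "receipt u = (\<Sum>i\<in>?D. pay (flip i u)) + (\<Sum>i\<in>dirs u - ?D. pay (flip i u))"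
    unfolding receipt_star[OF star] by (subst sum.subset_diff[of ?D]) auto
  ultimately show ?thesis using n_ge_11 by linarith
qed

lemma receipt_star_nonneg:
  assumes star: "star a u" and not_tight: "\<forall>b. \<not> tight a b u"
  shows "0 \<le> receipt u"
proof (cases "\<forall>i\<in>dirs u. hub_dirs (flip i u) = {i}")
  case True
  have "(real n - 1) * (\<theta> - 1 / 2) = (real n - 1) * \<theta> - (real n - 3) / 2 - 1"
    by (simp add: field_simps)
  then show ?thesis
    using receipt_star_unshared[OF star True] star_sum_loss_ge_not_tight[OF star not_tight]
      mult_\<theta>_le[of "real n - 1"] n_ge_11 by linarith
next
  case False
  then show ?thesis using receipt_star_shared[OF star] by blast
qed

lemma receipt_nonneg:
  assumes hub: "v \<in> hubs" and not_tight: "\<forall>a b. \<not> tight a b v"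
  shows "0 \<le> receipt v"
proof (cases "\<exists>i\<in>dirs v. \<exists>a j. deficient a j (flip i v)")
  case True
  then obtain i a j where dir: "i \<in> dirs v" and deficient: "deficient a j (flip i v)" by blast
  have "i \<in> hub_dirs (flip i v)" using dir hub by (simp add: hub_dirs_def dirs_iff)
  then have "i = j" using deficient_hub_dirs[OF deficient] by simp
  then have "star a v" using deficient_star[OF deficient] by simp
  then show ?thesis using receipt_star_nonneg not_tight by blast
next
  case False
  then have "0 \<le> pay (flip i v)" if "i \<in> dirs v" for i
    using \<theta>_le_loss[of "flip i v"] that by (auto simp: pay_def dirs_iff)
  then show ?thesis unfolding receipt_def by (intro sum_nonneg) auto
qed

lemma receipt_tight_center:
  assumes tight: "tight a b u"
  shows "(real n - 1) * (1 / 2 - \<theta>) \<le> receipt u"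
proof -
  have "receipt u = (\<Sum>i\<in>dirs u. loss (flip i u)) - (real n - 1) * \<theta>"
    using tight_hub_dirs[OF tight] by (intro receipt_star_unshared[OF tight_star[OF tight]]) auto
  then show ?thesis using tight_sum_loss_ge[OF tight] by (simp add: algebra_simps)
qed

lemma receipt_second_center:
  assumes tight: "tight a b u" and center: "w \<in> second_centers a b u"
  shows "(real n - 3) / 60 \<le> receipt w"
proof -
  obtain j where center_eq: "j \<in> dirs u - {b}" "w = flip j (apex a b u)" "dirs w = {..<n} - {a, b}"
    using second_centerE[OF tight center] .
  have apex: "j \<in> dirs w" "flip j w = apex a b u"
    using center_eq(1,2) apex_code[OF tight] by (simp_all add: dirs_iff)
  have length_w: "length w = n"
    using code_in_space[OF apex_code[OF tight]] center_eq(2) by (simp add: hamming_space_def)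
  have not_apex: "flip k w \<noteq> apex a b u" if "k \<in> dirs w - {j}" for k
    using inj_onD[OF inj_on_flip[of w], of k j] apex that length_w by (auto simp: dirs_iff)
  then have members: "{k. k \<in> dirs w \<and> flip k w \<notin> apexes} = dirs w - {j}"
    using second_member_apex_iff[OF tight center] apex by blast
  have "1 / 60 \<le> pay (flip k w)" if "k \<in> dirs w - {j}" for k
    using second_member_loss[OF tight center _ not_apex[OF that]] that \<theta>_le_second_member
    by (auto simp: pay_def)
  then have "card (dirs w - {j}) * (1 / 60) \<le> receipt w"
    unfolding receipt_def members by (intro sum_bounded_below) auto
  moreover have "card (dirs w) = n - 2"
    using second_center_hub[OF tight center] by (simp add: hubs_def cov_noncode)
  then have "real (card (dirs w - {j})) = real n - 3"
    using apex(1) n_ge_11 by (simp add: of_nat_diff)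
  ultimately show ?thesis by simp
qed

lemma cluster_balance:
  assumes tight: "tight a b u"
  shows "0 \<le> loss (apex a b u) - \<theta> + (\<Sum>v\<in>cluster (a, b, u). receipt v)"
proof -
  let ?S = "second_centers a b u"
  have "?S \<subseteq> hubs" using second_center_hub(1)[OF tight] by blast
  then have finite_second: "finite ?S" using finite_hubs by (rule finite_subset)
  have "cov u \<noteq> n - 2" using star_cov[OF tight_star[OF tight]] n_ge_11 by simp
  then have "u \<notin> ?S" using second_center_hub(2)[OF tight] by blast
  then have sum_cluster: "(\<Sum>v\<in>cluster (a, b, u). receipt v) = receipt u + (\<Sum>w\<in>?S. receipt w)"
    using finite_second by (simp add: cluster_def)
  have excess: "(real n - 1) * (1 / 2 - \<theta>) = 1 / 2 - real n * (\<theta> - 1 / 2) - (1 - \<theta>)"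
    by (simp add: field_simps)
  show ?thesis
  proof (cases "?S = {}")
    case True
    then show ?thesis
      using apex_loss_ge_no_second_center[OF tight] receipt_tight_center[OF tight]
        \<theta>_le_average sum_cluster excess by simp
  next
    case False
    then obtain w where center: "w \<in> ?S" by blast
    have "receipt w \<le> (\<Sum>w\<in>?S. receipt w)"
    proof (rule member_le_sum[OF center _ finite_second])
      fix x assume "x \<in> ?S - {w}"
      then have "(real n - 3) / 60 \<le> receipt x" using receipt_second_center[OF tight] by blast
      then show "0 \<le> receipt x" using n_ge_11 by simp
    qed
    then show ?thesis
      using apex_loss_ge_second_center[OF tight center] receipt_second_center[OF tight center]
        receipt_tight_center[OF tight] \<theta>_le_average_second sum_cluster excess by linarith
  qed
qed

lemma cluster_subset_hubs: "t \<in> tight_stars \<Longrightarrow> cluster t \<subseteq> hubs"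
  using star_hub[OF tight_star] second_center_hub(1) by (auto simp: tight_stars_def cluster_def)

lemma disjoint_clusters:
  assumes in_tight_stars: "t \<in> tight_stars" "t' \<in> tight_stars" and "v \<in> cluster t" "v \<in> cluster t'"
  shows "t = t'"
proof -
  obtain a b u a' b' u' where eqs: "t = (a, b, u)" "t' = (a', b', u')" by (metis prod_cases3)
  have tight: "tight a b u" "tight a' b' u'"
    using in_tight_stars by (simp_all add: tight_stars_def eqs)
  have "cov u = n - 1" "cov u' = n - 1" "n - 1 \<noteq> n - 2"
    using star_cov[OF tight_star] tight n_ge_11 by auto
  then consider (centers) "v = u" "v = u'"
    | (second_centers) "v \<in> second_centers a b u" "v \<in> second_centers a' b' u'"
    using assms(3,4) second_center_hub(2)[OF tight(1)] second_center_hub(2)[OF tight(2)]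
    by (auto simp: cluster_def eqs)
  then show ?thesis
  proof cases
    case centers
    then show ?thesis using tight_center_inj[of a b u a' b'] tight by (simp add: eqs)
  next
    case second_centers
    then show ?thesis using second_center_inj[OF tight] by (simp add: eqs)
  qed
qed

lemma finite_tight_stars: "finite tight_stars"
proof (rule finite_subset)
  show "tight_stars \<subseteq> {..<n} \<times> {..<n} \<times> hamming_space n"
    using tight_dirs_less tight_star by (auto simp: tight_stars_def star_def)
qed (simp add: finite_hamming_space)

lemma sum_receipt_clusters_le:
  "(\<Sum>t\<in>tight_stars. \<Sum>v\<in>cluster t. receipt v) \<le> (\<Sum>v\<in>hubs. receipt v)"
proof -
  have "(\<Sum>t\<in>tight_stars. \<Sum>v\<in>cluster t. receipt v) = (\<Sum>v\<in>(\<Union>t\<in>tight_stars. cluster t). receipt v)"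
    using finite_tight_stars finite_subset[OF cluster_subset_hubs finite_hubs] disjoint_clusters
    by (intro sum.UNION_disjoint[symmetric]) blast+
  also have "\<dots> \<le> (\<Sum>v\<in>hubs. receipt v)"
  proof (intro sum_mono2)
    fix v assume outside: "v \<in> hubs - (\<Union>t\<in>tight_stars. cluster t)"
    have "\<not> tight a b v" for a b
    proof
      assume "tight a b v"
      then have "(a, b, v) \<in> tight_stars" "v \<in> cluster (a, b, v)"
        by (simp_all add: tight_stars_def cluster_def)
      then show False using outside by blast
    qed
    then show "0 \<le> receipt v" using outside receipt_nonneg by blast
  qed (use finite_hubs cluster_subset_hubs in auto)
  finally show ?thesis .
qed

lemma sum_apexes: "(\<Sum>c\<in>apexes. f c) = (\<Sum>(a, b, u)\<in>tight_stars. f (apex a b u))"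
proof -
  let ?apex = "\<lambda>(a, b, u). apex a b u"
  have "inj_on ?apex tight_stars"
    using apex_inj by (auto simp: inj_on_def tight_stars_def)
  then show ?thesis by (simp add: apexes_def sum.reindex case_prod_unfold comp_def)
qed

lemma sum_loss_ge: "card C * \<theta> \<le> (\<Sum>c\<in>C. loss c)"
proof -
  have "0 \<le> (\<Sum>t\<in>tight_stars. (case t of (a, b, u) \<Rightarrow> loss (apex a b u) - \<theta>)
      + (\<Sum>v\<in>cluster t. receipt v))"
    using cluster_balance by (intro sum_nonneg) (auto simp: tight_stars_def)
  also have "\<dots> = (\<Sum>c\<in>apexes. loss c - \<theta>) + (\<Sum>t\<in>tight_stars. \<Sum>v\<in>cluster t. receipt v)"
    by (simp add: sum.distrib sum_apexes)
  also have "\<dots> \<le> (\<Sum>c\<in>apexes. loss c - \<theta>) + (\<Sum>v\<in>hubs. receipt v)"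
    using sum_receipt_clusters_le by simp
  also have "\<dots> \<le> (\<Sum>c\<in>apexes. loss c - \<theta>) + (\<Sum>c\<in>C - apexes. loss c - \<theta>)"
    unfolding sum_receipt using hub_pay_le by (intro add_left_mono sum_mono) auto
  also have "\<dots> = (\<Sum>c\<in>C. loss c - \<theta>)"
    using finite_code apex_code by (subst sum.subset_diff[of apexes C]) (auto elim: apexE)
  finally show ?thesis by (simp add: sum_subtractf)
qed

end

section \<open>Lower bounds\<close>

lemma gamma_LD_ge:
  assumes "11 \<le> n" and "\<theta> \<le> 2 / 3 - 1 / (real n - 4)"
    and "real n * (\<theta> - 1 / 2) \<le> 2 / 3 - 1 / (real n - 5)"
  shows "2 ^ (n + 1) / (real n + 3 - 2 * \<theta>) \<le> gamma_LD n"
proof -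
  obtain C where code: "locating_dominating n C" "card C = gamma_LD n"
    using gamma_LD_attained by blast
  interpret ld_code_threshold n C \<theta> using assms code(1) by unfold_locales
  have "2 ^ (n + 1) \<le> gamma_LD n * (real n + 3 - 2 * \<theta>)"
    using sum_loss_ge sum_loss_eq code(2) by (simp add: field_simps)
  moreover have "0 < real n + 3 - 2 * \<theta>" using \<theta>_le_two_thirds by simp
  ultimately show ?thesis by (simp add: divide_le_eq)
qed

lemma gamma_LD_ge_large:
  assumes "13 \<le> n"
  shows "2 ^ (n + 1) / (real n + 2 + 2 / ((real n)\<^sup>2 - 5 * real n) - 4 / (3 * real n)) \<le> gamma_LD n"
proof -
  define \<theta> where "\<theta> = 1 / 2 + (2 / 3 - 1 / (real n - 5)) / real n"
  have "real n * (\<theta> - 1 / 2) \<le> 2 / 3 - 1 / (real n - 5)"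
    using assms by (simp add: \<theta>_def)
  moreover have "\<theta> \<le> 2 / 3 - 1 / (real n - 4)"
  proof -
    have "(2 / 3 - 1 / (real n - 5)) / real n \<le> (2 / 3) / 13"
      using assms by (intro frac_le) auto
    moreover have "1 / (real n - 4) \<le> 1 / 9" using assms by (intro divide_left_mono) auto
    ultimately show ?thesis unfolding \<theta>_def by linarith
  qed
  ultimately have "2 ^ (n + 1) / (real n + 3 - 2 * \<theta>) \<le> gamma_LD n"
    using assms by (intro gamma_LD_ge) auto
  moreover have "real n + 3 - 2 * \<theta>
      = real n + 2 + 2 / ((real n)\<^sup>2 - 5 * real n) - 4 / (3 * real n)"
    by (simp add: \<theta>_def diff_divide_distrib power2_eq_square algebra_simps)
  ultimately show ?thesis by (simp only:)
qed

theorem theorem7: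
  fixes n :: nat
  shows "(11 \<le> n \<and> n \<le> 12 \<longrightarrow>
            real (gamma_LD n) \<ge>
              2 ^ (n + 1) / (real n + 1 + 2 * (real n - 1) / (3 * (real n - 4)))) \<and>
         (n \<ge> 13 \<longrightarrow>
            real (gamma_LD n) \<ge>
              2 ^ (n + 1) / (real n + 2 + 2 / ((real n)\<^sup>2 - 5 * real n) - 4 / (3 * real n)))"
proof (intro conjI impI)
  assume "11 \<le> n \<and> n \<le> 12"
  then consider "n = 11" | "n = 12" by linarith
  then show "real (gamma_LD n) \<ge>
      2 ^ (n + 1) / (real n + 1 + 2 * (real n - 1) / (3 * (real n - 4)))"
    using gamma_LD_ge[of n "2 / 3 - 1 / (real n - 4)"] by cases simp_all
qed (rule gamma_LD_ge_large)

end
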